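(* Let $b=(b_0,b_1,b_2,\ldots)$ be an infinite sequence of integers, regarded as a function $b:\mathbb{Z}_{\ge 0}\to\mathbb{Z}$ with $b(x)=b_x$. Assume that (1) $b(0)$ is odd, and (2) $2^{m+1}\mid(\Delta^m b)(x)$ for all integers $m\ge 1$ and all $x\in\mathbb{Z}_{\ge 0}$. Then for every integer $n\ge 0$, $$\xi(C_n^b)=\xi(C_n)=s(n+1)-1.$$
   Context: $\mathbb{Z}_{\ge 0}$ denotes the nonnegative integers. The difference operator $\Delta$ acts on functions $f:\mathbb{Z}_{\ge 0}\to\mathbb{Z}$ by $(\Delta f)(x)=f(x+1)-f(x)$, and $\Delta^m$ is its $m$-fold iterate. $\xi(k)$ denotes the base two exponent of an integer $k$, i.e. the exponent of the largest power of $2$ dividing $k$ (the $2$-adic valuation). $s(k)$ denotes the sum of the digits in the binary expansion of $k$. $C_n=\frac{1}{n+1}\binom{2n}{n}$ is the $n$th Catalan number. A Dyck path $P$ of length $2n$ is a sequence of lattice points $(x_0,y_0)=(0,0),(x_1,y_1),\ldots,(x_{2n},y_{2n})=(2n,0)$ in the upper half-plane (all $y_i\ge 0$) such that each step $[x_i-x_{i-1},y_i-y_{i-1}]$ is $[1,1]$ or $[1,-1]$. The height of the $i$th step is $y_{i-1}$. The weight of $P$ is $\mathrm{wt}(P)=b_{h_1}b_{h_2}\cdots b_{h_n}$, where $h_1,\ldots,h_n$ are the heights of the steps of $P$ of the form $[1,1]$. The weighted Catalan number is $C_n^b=\sum_P \mathrm{wt}(P)$, the sum being over all Dyck paths of length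 $2n$. (Equivalently, the $C_n^b$ are the coefficients in the expansion of the continued fraction $\cfrac{1}{1-\cfrac{b_0x}{1-\cfrac{b_1x}{1-\cfrac{b_2x}{1-\cdots}}}}=\sum_{n\ge 0}C_n^b x^n$.) *)

theory Defs
  imports "HOL-Computational_Algebra.Computational_Algebra" "HOL-Library.Product_Plus"
begin

definition fwd_diff :: "(nat \<Rightarrow> int) \<Rightarrow> nat \<Rightarrow> int" where
  "fwd_diff f x = f (x + 1) - f x"

(* The summand is the i-th binary digit of k; it vanishes for i \<ge> k because k < 2 ^ k. *)
definition binary_digit_sum :: "nat \<Rightarrow> nat" where
  "binary_digit_sum k = (\<Sum>i<k. k div 2 ^ i mod 2)"

(* The division is exact, see Suc_mult_catalan. *)
definition catalan :: "nat \<Rightarrow> nat" where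
  "catalan n = (2 * n choose n) div (n + 1)"

lemma Suc_mult_catalan: "(n + 1) * catalan n = 2 * n choose n"
proof -
  have "Suc n * (2 * n choose Suc n) = n * (2 * n choose n)"
    using binomial_absorption[of n "2 * n"] binomial_absorb_comp[of "2 * n" n]
    by (cases "n = 0") (simp_all del: binomial_Suc_Suc mult_Suc)
  hence "Suc n dvd n * (2 * n choose n)"
    by (metis dvd_triv_left)
  hence "Suc n dvd (2 * n choose n)"
    using coprime_Suc_left_nat coprime_dvd_mult_right_iff by blast
  thus ?thesis
    by (simp add: catalan_def del: mult_Suc)
qed

(* A path is the list of its points p ! 0, ..., p ! (2 * n). *)
definition dyck_paths :: "nat \<Rightarrow> (int \<times> int) list set" where
  "dyck_paths n = {p. length p = 2 * n + 1 \<and> p ! 0 = (0, 0) \<and> p ! (2 * n) = (int (2 * n), 0) \<and>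
     (\<forall>i\<le>2 * n. snd (p ! i) \<ge> 0) \<and>
     (\<forall>i\<in>{1..2 * n}. p ! i - p ! (i - 1) \<in> {(1, 1), (1, -1)})}"

(* The product is indexed by the up-steps, so repeated heights contribute repeated factors.
   On Dyck paths the argument of nat is nonnegative. *)
definition path_weight :: "(nat \<Rightarrow> int) \<Rightarrow> (int \<times> int) list \<Rightarrow> int" where
  "path_weight b p =
     (\<Prod>i | i \<in> {1..<length p} \<and> p ! i - p ! (i - 1) = (1, 1). b (nat (snd (p ! (i - 1)))))"

definition weighted_catalan :: "(nat \<Rightarrow> int) \<Rightarrow> nat \<Rightarrow> int" where
  "weighted_catalan b n = (\<Sum>p\<in>dyck_paths n. path_weight b p)"

lemma finite_dyck_paths: "finite (dyck_paths n)"
proof (rule finite_subset)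
  let ?A = "{0..int (2 * n)} \<times> {0..int (2 * n)}"
  show "finite {p. set p \<subseteq> ?A \<and> length p = 2 * n + 1}"
    by (rule finite_lists_length_eq) simp
  show "dyck_paths n \<subseteq> {p. set p \<subseteq> ?A \<and> length p = 2 * n + 1}"
  proof
    fix p assume p: "p \<in> dyck_paths n"
    have bound: "i \<le> 2 * n \<Longrightarrow> fst (p ! i) = int i \<and> snd (p ! i) \<le> int i" for i
    proof (induction i)
      case 0
      then show ?case using p by (simp add: dyck_paths_def)
    next
      case (Suc i)
      have "Suc i \<in> {1..2 * n}" using Suc.prems by simp
      hence "p ! Suc i - p ! (Suc i - 1) \<in> {(1, 1), (1, -1)}"
        using p unfolding dyck_paths_def by blast
      hence "p ! Suc i - p ! i \<in> {(1, 1), (1, -1)}" by simp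
      thus ?case using Suc by (auto simp: prod_eq_iff)
    qed
    have "q \<in> ?A" if q: "q \<in> set p" for q
    proof -
      obtain i where i: "i < length p" "q = p ! i"
        using q by (auto simp: in_set_conv_nth)
      hence i': "i \<le> 2 * n" using p by (simp add: dyck_paths_def)
      have "snd (p ! i) \<ge> 0" using p i' by (simp add: dyck_paths_def)
      thus ?thesis using bound[OF i'] i i' by (auto simp: mem_Times_iff)
    qed
    thus "p \<in> {p. set p \<subseteq> ?A \<and> length p = 2 * n + 1}"
      using p by (auto simp: dyck_paths_def)
  qed
qed

end

theory Submission
  imports Defs
begin

text \<open>
  Let \<open>c\<^sub>n(x)\<close> be the weighted Catalan number of the sequence \<open>b\<close> shifted by \<open>x\<close>, so that
  \<open>c\<^bsub>n+1\<^esub>(x) = b(x) \<Sum>\<^sub>k c\<^sub>k(x + 1) c\<^bsub>n-k\<^esub>(x)\<close>. By induction, \<open>c\<^sub>n = 2\<^sup>v f\<close>, where \<open>2\<^sup>v\<close> is the power of two in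
  \<open>C\<^sub>n\<close> and \<open>f\<close> is odd and satisfies the same difference conditions as \<open>b\<close>. Pairing \<open>k\<close> with \<open>n - k\<close>
  gains a factor \<open>2\<close>, which together with subadditivity of the binary digit sum makes every pair
  divisible by the power of two in \<open>C\<^bsub>n+1\<^esub>\<close>. The parity of the cofactor of \<open>c\<^bsub>n+1\<^esub>\<close> does not depend
  on \<open>b\<close>, so the case \<open>b = 1\<close> of the ordinary Catalan numbers shows that it is odd.
\<close>

section \<open>Binary digit sums\<close>

lemma binary_digit_sum_extend:
  assumes "k \<le> N"
  shows "binary_digit_sum k = (\<Sum>i<N. k div 2 ^ i mod 2)"
  unfolding binary_digit_sum_def
proof (rule sum.mono_neutral_left)
  show "\<forall>i\<in>{..<N} - {..<k}. k div 2 ^ i mod 2 = 0"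
  proof
    fix i assume "i \<in> {..<N} - {..<k}"
    hence "k \<le> i" by simp
    also have "i < 2 ^ i" by (rule less_exp)
    finally show "k div 2 ^ i mod 2 = 0" by simp
  qed
qed (use assms in auto)

lemma binary_digit_sum_rec: "binary_digit_sum k = k mod 2 + binary_digit_sum (k div 2)"
proof -
  have "binary_digit_sum k = (\<Sum>i<Suc k. k div 2 ^ i mod 2)"
    by (rule binary_digit_sum_extend) simp
  also have "\<dots> = k mod 2 + (\<Sum>i<k. k div 2 div 2 ^ i mod 2)"
    by (subst sum.lessThan_Suc_shift) (simp add: div_mult2_eq)
  also have "(\<Sum>i<k. k div 2 div 2 ^ i mod 2) = binary_digit_sum (k div 2)"
    by (rule binary_digit_sum_extend [symmetric]) simp
  finally show ?thesis .
qed

lemma binary_digit_sum_double [simp]: "binary_digit_sum (2 * k) = binary_digit_sum k"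
  by (subst binary_digit_sum_rec) simp

lemma binary_digit_sum_Suc_double [simp]:
  "binary_digit_sum (Suc (2 * k)) = Suc (binary_digit_sum k)"
  by (subst binary_digit_sum_rec) simp

text \<open>Adding 1 clears the trailing block of ones and sets the next digit; the length of that
  block is the valuation of \<open>Suc k\<close>.\<close>

lemma binary_digit_sum_Suc:
  "binary_digit_sum (Suc k) + multiplicity 2 (Suc k) = Suc (binary_digit_sum k)"
proof (induction k rule: less_induct)
  case (less k)
  show ?case
  proof (cases "even k")
    case True
    then obtain j where "k = 2 * j" by blast
    then show ?thesis by (simp add: not_dvd_imp_multiplicity_0)
  next
    case False
    then obtain j where j: "k = Suc (2 * j)" by (auto elim: oddE)
    have "multiplicity 2 (2 * Suc j) = Suc (multiplicity 2 (Suc j))"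
      by (rule multiplicity_times_same) auto
    moreover have "Suc k = 2 * Suc j" using j by simp
    moreover have "binary_digit_sum (Suc j) + multiplicity 2 (Suc j) = Suc (binary_digit_sum j)"
      using less.IH j by simp
    ultimately show ?thesis
      using j by (simp only: binary_digit_sum_double binary_digit_sum_Suc_double add_Suc_right)
  qed
qed

text \<open>Each carry merges two ones into one. The last digits produce a carry only when both are
  1, and \<open>binary_digit_sum_Suc\<close> bounds its effect.\<close>

lemma binary_digit_sum_add_le:
  "binary_digit_sum (i + j) \<le> binary_digit_sum i + binary_digit_sum j"
proof (induction "i + j" arbitrary: i j rule: less_induct)
  case less
  show ?case
  proof (cases "i + j = 0")
    case False
    define i' j' where "i' = i div 2" and "j' = j div 2"
    have IH: "binary_digit_sum (i' + j') \<le> binary_digit_sum i' + binary_digit_sum j'"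
      using less [of i' j'] False by (auto simp: i'_def j'_def)
    have carry: "binary_digit_sum (Suc (i' + j')) \<le> Suc (binary_digit_sum (i' + j'))"
      using binary_digit_sum_Suc [of "i' + j'"] by linarith
    have ij: "i = 2 * i' \<or> i = Suc (2 * i')" "j = 2 * j' \<or> j = Suc (2 * j')"
      unfolding i'_def j'_def by presburger+
    have "2 * i' + 2 * j' = 2 * (i' + j')" "Suc (2 * i' + 2 * j') = Suc (2 * (i' + j'))"
      "Suc (Suc (2 * i' + 2 * j')) = 2 * (Suc (i' + j'))" by simp_all
    then show ?thesis using ij IH carry
      by (elim disjE; simp only: add_Suc add_Suc_right binary_digit_sum_double
          binary_digit_sum_Suc_double; linarith)
  qed simp
qed

section \<open>Catalan numbers\<close>

lemma catalan_pos: "0 < catalan n"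
proof -
  have "0 < 2 * n choose n" by simp
  then show ?thesis using Suc_mult_catalan [of n] by (metis mult_0_right not_gr_zero)
qed

lemma catalan_Suc: "(n + 2) * catalan (Suc n) = 2 * (2 * n + 1) * catalan n"
proof -
  have "(Suc n * (2 * Suc n choose Suc n)) * Suc n = (Suc (Suc (2 * n)) * Suc (2 * n)) * (2 * n choose n)"
  proof -
    have a: "Suc n * (2 * Suc n choose Suc n) = Suc (Suc (2 * n)) * (Suc (2 * n) choose n)"
      using Suc_times_binomial_eq [of "Suc (2 * n)" n]
      by (metis mult.commute mult_Suc_right add_2_eq_Suc)
    have "(Suc (2 * n) choose n) = (Suc (2 * n) choose Suc n)"
      by (subst binomial_symmetric) (auto simp del: binomial_Suc_Suc)
    moreover have "Suc n * (Suc (2 * n) choose Suc n) = Suc (2 * n) * (2 * n choose n)"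
      using Suc_times_binomial_eq [of "2 * n" n]
      by (simp only: mult.commute)
    ultimately have "Suc n * (Suc (2 * n) choose n) = Suc (2 * n) * (2 * n choose n)" by simp
    then show ?thesis using a by (metis mult.assoc mult.commute)
  qed
  then have "Suc n * Suc n * ((n + 2) * catalan (Suc n)) = Suc n * Suc n * (2 * (2 * n + 1) * catalan n)"
    unfolding Suc_mult_catalan [of n, symmetric] Suc_mult_catalan [of "Suc n", symmetric]
    by (simp add: algebra_simps)
  then show ?thesis by (simp only: mult_cancel1 mult_is_0 nat.distinct simp_thms)
qed

lemma catalan_0 [simp]: "catalan 0 = 1"
  by (simp add: catalan_def)

text \<open>The right-hand side of \<open>catalan_Suc\<close> has exactly one more factor 2 than
  \<open>catalan n\<close>, so both sides here obey the recurrence of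
  \<open>binary_digit_sum_Suc\<close>.\<close>

lemma multiplicity_catalan: "Suc (multiplicity 2 (catalan n)) = binary_digit_sum (Suc n)"
proof (induction n)
  case 0
  then show ?case by (simp add: binary_digit_sum_def)
next
  case (Suc n)
  have "multiplicity 2 (Suc (Suc n)) + multiplicity 2 (catalan (Suc n))
      = multiplicity 2 ((n + 2) * catalan (Suc n))"
    using catalan_pos [of "Suc n"] by (subst prime_elem_multiplicity_mult_distrib) auto
  also have "\<dots> = multiplicity 2 (2 * (2 * n + 1) * catalan n)"
    by (simp only: catalan_Suc)
  also have "\<dots> = Suc (multiplicity 2 (catalan n))"
    using catalan_pos [of n]
    by (simp add: prime_elem_multiplicity_mult_distrib not_dvd_imp_multiplicity_0 del: mult_Suc mult_Suc_right)
  finally show ?case using Suc.IH binary_digit_sum_Suc [of "Suc n"] by linarith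
qed

text \<open>Reflecting \<open>k\<close> to \<open>n - k\<close> gives
  \<open>2 * T n = n * S n\<close>; the ratio recurrence applied termwise gives a second linear
  relation. Eliminating \<open>T\<close> leaves for \<open>S\<close> the recurrence
  \<open>catalan_Suc\<close>, one index later.\<close>

lemma catalan_convolution: "(\<Sum>k\<le>n. catalan k * catalan (n - k)) = catalan (Suc n)"
proof -
  define S where "S n = (\<Sum>k\<le>n. catalan k * catalan (n - k))" for n
  define T where "T n = (\<Sum>k\<le>n. k * (catalan k * catalan (n - k)))" for n
  have sym: "2 * T n = n * S n" for n
  proof -
    have "T n = (\<Sum>k\<le>n. (n - k) * (catalan k * catalan (n - k)))"
      unfolding T_def
      by (rule sum.reindex_bij_witness [of _ "\<lambda>k. n - k" "\<lambda>k. n - k"]) auto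
    then have "2 * T n = (\<Sum>k\<le>n. (k + (n - k)) * (catalan k * catalan (n - k)))"
      by (simp only: T_def mult_2 add_mult_distrib sum.distrib)
    also have "\<dots> = n * S n"
      unfolding S_def sum_distrib_left by (rule sum.cong) auto
    finally show ?thesis .
  qed
  have rec: "T (Suc n) + S (Suc n) = catalan (Suc n) + 4 * T n + 2 * S n" for n
  proof -
    have "T (Suc n) + S (Suc n) = (\<Sum>k\<le>Suc n. (k + 1) * catalan k * catalan (Suc n - k))"
      by (simp add: T_def S_def algebra_simps flip: sum.distrib)
    also have "\<dots> = catalan (Suc n) + (\<Sum>k\<le>n. (k + 2) * catalan (Suc k) * catalan (n - k))"
      by (subst sum.atMost_Suc_shift) simp
    also have "(\<Sum>k\<le>n. (k + 2) * catalan (Suc k) * catalan (n - k)) = 4 * T n + 2 * S n"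
      unfolding T_def S_def sum_distrib_left sum.distrib [symmetric] catalan_Suc
      by (rule sum.cong) (auto simp: algebra_simps)
    finally show ?thesis by simp
  qed
  have "S n = catalan (Suc n)"
  proof (induction n)
    case 0
    then show ?case using catalan_Suc [of 0] by (simp add: S_def)
  next
    case (Suc n)
    have "(n + 3) * S (Suc n) = 2 * (T (Suc n) + S (Suc n))"
      using sym [of "Suc n"] by (simp add: algebra_simps)
    also have "\<dots> = 2 * catalan (Suc n) + 4 * (2 * T n) + 4 * S n"
      by (simp add: rec)
    also have "\<dots> = (4 * n + 6) * catalan (Suc n)"
      unfolding sym Suc.IH by (simp add: algebra_simps)
    also have "\<dots> = (n + 3) * catalan (Suc (Suc n))"
      using catalan_Suc [of "Suc n"] by (simp add: algebra_simps)
    finally show ?case by simp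
  qed
  then show ?thesis by (simp add: S_def)
qed

section \<open>Decomposition of Dyck paths\<close>

text \<open>The value at \<open>x\<close> is the weighted Catalan number of the sequence shifted by \<open>x\<close>.\<close>

fun shifted_catalan :: "(nat \<Rightarrow> int) \<Rightarrow> nat \<Rightarrow> nat \<Rightarrow> int" where
  "shifted_catalan b 0 x = 1"
| "shifted_catalan b (Suc n) x =
     b x * (\<Sum>k\<le>n. shifted_catalan b k (Suc x) * shifted_catalan b (n - k) x)"

declare shifted_catalan.simps [simp del]

lemma shifted_catalan_one: "shifted_catalan (\<lambda>_. 1) n x = int (catalan n)"
proof (induction n arbitrary: x rule: less_induct)
  case (less n)
  show ?case
  proof (cases n)
    case (Suc m)
    then show ?thesis
      by (simp add: shifted_catalan.simps less.IH flip: catalan_convolution)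
  qed (simp add: shifted_catalan.simps)
qed

definition shifted_catalan_fps :: "(nat \<Rightarrow> int) \<Rightarrow> nat \<Rightarrow> int fps" where
  "shifted_catalan_fps b x = Abs_fps (\<lambda>n. shifted_catalan b n x)"

text \<open>One level of the continued fraction, with its denominator cleared.\<close>

lemma shifted_catalan_fps_eq:
  "shifted_catalan_fps b x =
     1 + fps_const (b x) * fps_X * shifted_catalan_fps b (Suc x) * shifted_catalan_fps b x"
proof (rule fps_ext)
  fix n
  show "fps_nth (shifted_catalan_fps b x) n = fps_nth (1 + fps_const (b x) * fps_X *
      shifted_catalan_fps b (Suc x) * shifted_catalan_fps b x) n"
    by (cases n) (simp_all add: shifted_catalan_fps_def shifted_catalan.simps mult.assoc
        fps_mult_nth [of "Abs_fps f" "Abs_fps g" for f g] atLeast0AtMost)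
qed

text \<open>Generating function, by number of up-steps, of the paths descending from height \<open>h\<close> to \<open>0\<close>:
  cutting such a path at its first visits to \<open>h - 1, \<dots>, 0\<close> leaves a Dyck path above every height.\<close>

definition descent_fps :: "(nat \<Rightarrow> int) \<Rightarrow> nat \<Rightarrow> int fps" where
  "descent_fps b h = (\<Prod>i\<le>h. shifted_catalan_fps b i)"

lemma descent_fps_0: "descent_fps b 0 = 1 + fps_const (b 0) * fps_X * descent_fps b (Suc 0)"
  using shifted_catalan_fps_eq [of b 0] by (simp add: descent_fps_def ac_simps)

text \<open>Mirrors the choice of the first step from height \<open>Suc h\<close>: down without
  weight, or up with weight \<open>b (Suc h)\<close>.\<close>

lemma descent_fps_Suc:
  "descent_fps b (Suc h) =
     descent_fps b h + fps_const (b (Suc h)) * fps_X * descent_fps b (Suc (Suc h))"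
proof -
  have "descent_fps b (Suc h) = descent_fps b h * shifted_catalan_fps b (Suc h)"
    by (simp add: descent_fps_def)
  also have "\<dots> = descent_fps b h * (1 + fps_const (b (Suc h)) * fps_X *
      shifted_catalan_fps b (Suc (Suc h)) * shifted_catalan_fps b (Suc h))"
    by (subst shifted_catalan_fps_eq) simp
  also have "\<dots> = descent_fps b h + fps_const (b (Suc h)) * fps_X * descent_fps b (Suc (Suc h))"
    by (simp add: descent_fps_def algebra_simps)
  finally show ?thesis .
qed

text \<open>An arbitrary starting point keeps the family closed under removing the first step. The
  height is an integer so that a step below \<open>0\<close> is expressible; it leads to an empty
  set.\<close>

definition descents :: "int \<Rightarrow> int \<Rightarrow> nat \<Rightarrow> (int \<times> int) list set" where
  "descents a h L = {p. length p = Suc L \<and> p ! 0 = (a, h) \<and> p ! L = (a + int L, 0) \<and>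
     (\<forall>i\<le>L. snd (p ! i) \<ge> 0) \<and> (\<forall>i<L. p ! Suc i - p ! i \<in> {(1, 1), (1, -1)})}"

lemma dyck_paths_eq_descents: "dyck_paths n = descents 0 0 (2 * n)"
proof -
  have "(\<forall>i\<in>{1..2 * n}. p ! i - p ! (i - 1) \<in> A) = (\<forall>i<2 * n. p ! Suc i - p ! i \<in> A)"
    for p :: "(int \<times> int) list" and A
  proof -
    have "{1..2 * n} = Suc ` {..<2 * n}" by (simp add: image_Suc_lessThan)
    then show ?thesis by (simp add: lessThan_def del: image_Collect)
  qed
  then show ?thesis by (simp only: dyck_paths_def descents_def) simp
qed

lemma descents_0: "descents a h 0 = (if h = 0 then {[(a, 0)]} else {})"
  by (auto simp: descents_def length_Suc_conv)

lemma descents_neg: "h < 0 \<Longrightarrow> descents a h L = {}"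
  by (force simp: descents_def)

lemma descents_Suc:
  assumes "0 \<le> h"
  shows "descents a h (Suc L) = (#) (a, h) ` (descents (a + 1) (h + 1) L \<union> descents (a + 1) (h - 1) L)"
proof (intro set_eqI)
  fix p
  have "(q ! 0 - (a, h) \<in> {(1, 1), (1, -1)}) \<longleftrightarrow> (q ! 0 = (a + 1, h + 1) \<or> q ! 0 = (a + 1, h - 1))"
    for q :: "(int \<times> int) list"
    by (cases "q ! 0") auto
  moreover have "(\<forall>i\<le>Suc L. P i) \<longleftrightarrow> P 0 \<and> (\<forall>i\<le>L. P (Suc i))" for P
    by (metis Suc_le_mono bot_nat_0.extremum not0_implies_Suc)
  ultimately show "p \<in> descents a h (Suc L) \<longleftrightarrow>
      p \<in> (#) (a, h) ` (descents (a + 1) (h + 1) L \<union> descents (a + 1) (h - 1) L)"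
    using assms
    by (cases p) (auto simp: descents_def image_iff All_less_Suc2)
qed

lemma finite_descents: "finite (descents a h L)"
proof (induction L arbitrary: a h)
  case (Suc L)
  then show ?case
    by (cases "0 \<le> h") (simp_all add: descents_Suc descents_neg)
qed (simp add: descents_0)

lemma path_weight_Cons:
  assumes "p \<noteq> []"
  shows "path_weight b (q # p) =
    (if p ! 0 - q = (1, 1) then b (nat (snd q)) else 1) * path_weight b p"
proof -
  \<comment> \<open>Replacing the filter by factors 1 over the full range of steps lets the first
    step be split off.\<close>
  have w: "path_weight b r =
      (\<Prod>i<length r - 1. if r ! Suc i - r ! i = (1, 1) then b (nat (snd (r ! i))) else 1)" for r
  proof -
    have "path_weight b r =
        (\<Prod>i | i \<in> {..<length r - 1} \<and> r ! Suc i - r ! i = (1, 1). b (nat (snd (r ! i))))"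
      unfolding path_weight_def by (rule prod.reindex_bij_witness [of _ Suc "\<lambda>i. i - 1"]) auto
    then show ?thesis by (subst (asm) prod.inter_filter) simp_all
  qed
  obtain n where "length p = Suc n" using assms by (cases p) auto
  then show ?thesis by (simp add: w prod.lessThan_Suc_shift cong: if_cong del: prod.lessThan_Suc)
qed

text \<open>A path with \<open>u\<close> up-steps and \<open>u + h\<close> down-steps has length
  \<open>2 * u + h\<close>. Removing the first step reproduces the recurrences
  \<open>descent_fps_0\<close> and \<open>descent_fps_Suc\<close>.\<close>

lemma sum_path_weight_descents:
  assumes "L = 2 * u + h"
  shows "(\<Sum>p\<in>descents a (int h) L. path_weight b p) = fps_nth (descent_fps b h) u"
  using assms
proof (induction L arbitrary: a h u)
  case 0
  then show ?case
    by (simp add: descents_0 descent_fps_def shifted_catalan_fps_def shifted_catalan.simps path_weight_def)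
next
  case (Suc L)
  let ?U = "descents (a + 1) (int h + 1) L" and ?D = "descents (a + 1) (int h - 1) L"
  have disj: "?U \<inter> ?D = {}" by (auto simp: descents_def)
  have U: "p \<noteq> []" "p ! 0 = (a + 1, int h + 1)" if "p \<in> ?U" for p
    using that by (auto simp: descents_def)
  have D: "p \<noteq> []" "p ! 0 = (a + 1, int h - 1)" if "p \<in> ?D" for p
    using that by (auto simp: descents_def)
  have "(\<Sum>p\<in>descents a (int h) (Suc L). path_weight b p)
      = (\<Sum>p\<in>?U \<union> ?D. path_weight b ((a, int h) # p))"
    by (simp add: descents_Suc sum.reindex)
  also have "\<dots> = (\<Sum>p\<in>?U. path_weight b ((a, int h) # p)) + (\<Sum>p\<in>?D. path_weight b ((a, int h) # p))"
    by (rule sum.union_disjoint) (simp_all add: finite_descents disj)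
  also have "(\<Sum>p\<in>?U. path_weight b ((a, int h) # p)) = b h * (\<Sum>p\<in>?U. path_weight b p)"
    unfolding sum_distrib_left
    by (rule sum.cong) (simp_all add: U path_weight_Cons)
  also have "(\<Sum>p\<in>?D. path_weight b ((a, int h) # p)) = (\<Sum>p\<in>?D. path_weight b p)"
    by (rule sum.cong) (simp_all add: D path_weight_Cons)
  also have "b h * (\<Sum>p\<in>?U. path_weight b p) = fps_nth (fps_const (b h) * fps_X * descent_fps b (Suc h)) u"
  proof (cases u)
    case 0
    \<comment> \<open>Here \<open>L + 1 = h\<close>, so there are too few steps to come down from
      height \<open>h + 1\<close>.\<close>
    have "?U = {}"
    proof (rule ccontr)
      assume "?U \<noteq> {}"
      then obtain p where p: "p \<in> ?U" by blast
      have "i \<le> L \<Longrightarrow> snd (p ! i) \<ge> int h + 1 - int i" for i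
      proof (induction i)
        case 0
        then show ?case using p by (simp add: descents_def)
      next
        case (Suc i)
        then have "p ! Suc i - p ! i \<in> {(1, 1), (1, -1)}" using p by (simp add: descents_def)
        then show ?case using Suc by (auto simp: prod_eq_iff)
      qed
      from this [of L] p show False using Suc.prems 0 by (simp add: descents_def)
    qed
    then show ?thesis using 0 by (simp add: mult.assoc)
  next
    case (Suc v)
    then have "L = 2 * v + Suc h" using Suc.prems by simp
    from Suc.IH [OF this, of "a + 1"] show ?thesis using Suc by (simp add: mult.assoc add.commute)
  qed
  also have "fps_nth (fps_const (b h) * fps_X * descent_fps b (Suc h)) u + (\<Sum>p\<in>?D. path_weight b p)
      = fps_nth (descent_fps b h) u"
  proof (cases h)
    \<comment> \<open>No path starts below \<open>0\<close>, and \<open>Suc L = 2 * u\<close> forces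
      \<open>u > 0\<close>, so the constant 1 in \<open>descent_fps_0\<close> does not
      contribute.\<close>
    case 0
    then show ?thesis using Suc.prems
      by (cases u) (simp_all add: descents_neg descent_fps_0)
  next
    case (Suc g)
    then have "L = 2 * u + g" using Suc.prems by simp
    from Suc.IH [OF this, of "a + 1"] show ?thesis using Suc by (simp add: descent_fps_Suc [of b g])
  qed
  finally show ?case .
qed

lemma weighted_catalan_eq: "weighted_catalan b n = shifted_catalan b n 0"
  using sum_path_weight_descents [of "2 * n" n 0 b 0]
  by (simp add: weighted_catalan_def dyck_paths_eq_descents descent_fps_def shifted_catalan_fps_def)

section \<open>Divisibility of iterated differences\<close>

text \<open>A filtration by powers of 2: each differencing raises the level \<open>r\<close> by one,
  and levels add under multiplication.\<close>

definition diff_dvd :: "nat \<Rightarrow> (nat \<Rightarrow> int) \<Rightarrow> bool" where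
  "diff_dvd r f \<longleftrightarrow> (\<forall>m x. 2 ^ (m + r) dvd (fwd_diff ^^ m) f x)"

lemma funpow_fwd_diff_add:
  "(fwd_diff ^^ m) (\<lambda>x. f x + g x) = (\<lambda>x. (fwd_diff ^^ m) f x + (fwd_diff ^^ m) g x)"
  by (induction m) (auto simp: fwd_diff_def)

lemma funpow_fwd_diff_cmult: "(fwd_diff ^^ m) (\<lambda>x. c * f x) = (\<lambda>x. c * (fwd_diff ^^ m) f x)"
  by (induction m) (auto simp: fwd_diff_def algebra_simps)

lemma funpow_fwd_diff_shift:
  "(fwd_diff ^^ m) (\<lambda>x. f (Suc x)) = (\<lambda>x. (fwd_diff ^^ m) f (Suc x))"
  by (induction m) (auto simp: fwd_diff_def)

lemma fwd_diff_mult: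
  "fwd_diff (\<lambda>x. f x * g x) = (\<lambda>x. fwd_diff f x * g (Suc x) + f x * fwd_diff g x)"
  by (auto simp: fwd_diff_def algebra_simps)

lemma diff_dvd_fwd_diff: "diff_dvd r f \<Longrightarrow> diff_dvd (Suc r) (fwd_diff f)"
  unfolding diff_dvd_def by (metis add_Suc_right add_Suc funpow_Suc_right o_apply)

lemma diff_dvd_add: "diff_dvd r f \<Longrightarrow> diff_dvd r g \<Longrightarrow> diff_dvd r (\<lambda>x. f x + g x)"
  by (simp add: diff_dvd_def funpow_fwd_diff_add)

lemma diff_dvd_shift: "diff_dvd r f \<Longrightarrow> diff_dvd r (\<lambda>x. f (Suc x))"
  by (simp add: diff_dvd_def funpow_fwd_diff_shift)

lemma diff_dvd_mono: "diff_dvd s f \<Longrightarrow> r \<le> s \<Longrightarrow> diff_dvd r f"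
  unfolding diff_dvd_def by (meson add_left_mono dvd_trans le_imp_power_dvd)

lemma diff_dvd_half: "diff_dvd (Suc r) (\<lambda>x. 2 * f x) \<Longrightarrow> diff_dvd r f"
  by (simp add: diff_dvd_def funpow_fwd_diff_cmult)

text \<open>In each term of the Leibniz rule \<open>fwd_diff_mult\<close> one factor gains a level,
  which pays for the additional difference.\<close>

lemma diff_dvd_mult:
  assumes "diff_dvd r f" "diff_dvd s g"
  shows "diff_dvd (r + s) (\<lambda>x. f x * g x)"
proof -
  have "2 ^ (m + (r + s)) dvd (fwd_diff ^^ m) (\<lambda>x. f x * g x) x" for m x
    using assms
  proof (induction m arbitrary: r s f g x)
    case 0
    then have "2 ^ r dvd f x" "2 ^ s dvd g x"
      unfolding diff_dvd_def by (metis add_0 funpow_0)+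
    then show ?case by (simp add: power_add mult_dvd_mono)
  next
    case (Suc m)
    have "2 ^ (m + (Suc r + s)) dvd (fwd_diff ^^ m) (\<lambda>x. fwd_diff f x * g (Suc x)) x"
      by (intro Suc.IH diff_dvd_fwd_diff diff_dvd_shift Suc.prems)
    moreover have "2 ^ (m + (r + Suc s)) dvd (fwd_diff ^^ m) (\<lambda>x. f x * fwd_diff g x) x"
      by (intro Suc.IH diff_dvd_fwd_diff Suc.prems)
    ultimately show ?case
      by (simp add: funpow_Suc_right fwd_diff_mult funpow_fwd_diff_add del: funpow.simps)
  qed
  then show ?thesis by (simp add: diff_dvd_def)
qed

text \<open>The difference condition imposed on \<open>b\<close>, with the order shifted by one so
  that the values of \<open>f\<close> itself stay unrestricted.\<close>

definition smooth :: "(nat \<Rightarrow> int) \<Rightarrow> bool" where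
  "smooth f \<longleftrightarrow> diff_dvd 2 (fwd_diff f)"

lemma smoothI:
  assumes "\<And>m x. m \<ge> 1 \<Longrightarrow> 2 ^ (m + 1) dvd (fwd_diff ^^ m) f x"
  shows "smooth f"
  unfolding smooth_def diff_dvd_def
proof (intro allI)
  fix m x
  show "2 ^ (m + 2) dvd (fwd_diff ^^ m) (fwd_diff f) x"
    using assms [of "Suc m" x] by (simp add: funpow_Suc_right del: funpow.simps)
qed

lemma smooth_imp_diff_dvd:
  assumes "smooth f"
  shows "diff_dvd 0 f"
  unfolding diff_dvd_def
proof (intro allI)
  fix m x
  show "2 ^ (m + 0) dvd (fwd_diff ^^ m) f x"
  proof (cases m)
    case (Suc k)
    have "diff_dvd 1 (fwd_diff f)"
      using assms by (auto simp: smooth_def intro: diff_dvd_mono)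
    then show ?thesis using Suc
      by (simp add: diff_dvd_def funpow_Suc_right del: funpow.simps)
  qed simp
qed

lemma diff_dvd_imp_smooth: "diff_dvd 1 f \<Longrightarrow> smooth f"
  unfolding smooth_def using diff_dvd_fwd_diff by (metis One_nat_def Suc_1)

lemma smooth_const [simp]: "smooth (\<lambda>_. c)"
proof -
  have "(fwd_diff ^^ m) (\<lambda>_. 0) = (\<lambda>_. 0)" for m
    by (induction m) (auto simp: fwd_diff_def)
  moreover have "fwd_diff (\<lambda>_. c) = (\<lambda>_. 0)" by (auto simp: fwd_diff_def)
  ultimately show ?thesis by (simp add: smooth_def diff_dvd_def)
qed

lemma smooth_add:
  assumes "smooth f" "smooth g"
  shows "smooth (\<lambda>x. f x + g x)"
  using diff_dvd_add [of 2 "fwd_diff f" "fwd_diff g"] assms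
    funpow_fwd_diff_add [of 1 f g] by (simp add: smooth_def)

lemma smooth_mult:
  assumes "smooth f" "smooth g"
  shows "smooth (\<lambda>x. f x * g x)"
  unfolding smooth_def fwd_diff_mult
  using diff_dvd_mult [of 2 "fwd_diff f" 0 "\<lambda>x. g (Suc x)"] diff_dvd_mult [of 0 f 2 "fwd_diff g", unfolded add_0] assms
  by (intro diff_dvd_add) (simp_all add: smooth_def smooth_imp_diff_dvd diff_dvd_shift)

lemma smooth_shift: "smooth f \<Longrightarrow> smooth (\<lambda>x. f (Suc x))"
  using diff_dvd_shift [of 2 "fwd_diff f"] funpow_fwd_diff_shift [of 1 f] by (simp add: smooth_def)

lemma smooth_sum: "(\<And>k. k \<in> A \<Longrightarrow> smooth (f k)) \<Longrightarrow> smooth (\<lambda>x. \<Sum>k\<in>A. f k x)"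
  by (induction A rule: infinite_finite_induct) (auto intro: smooth_add)

lemma smooth_parity:
  assumes "smooth f"
  shows "even (f x) \<longleftrightarrow> even (f 0)"
proof (induction x)
  case (Suc x)
  have "2 ^ (0 + 2) dvd (fwd_diff ^^ 0) (fwd_diff f) x"
    using assms unfolding smooth_def diff_dvd_def by blast
  then have "4 dvd f (Suc x) - f x" by (simp add: fwd_diff_def)
  moreover have "(2 :: int) dvd 4" by simp
  ultimately have "even (f (Suc x) - f x)" by (rule dvd_trans [rotated])
  then show ?case using Suc by simp
qed simp

definition odd_smooth :: "(nat \<Rightarrow> int) \<Rightarrow> bool" where
  "odd_smooth f \<longleftrightarrow> smooth f \<and> (\<forall>x. odd (f x))"

text \<open>Adding the two products gains exactly one factor \<open>2\<close>, since
  \<open>f (x + 1) g x + f x g (x + 1) = 2 f g + \<Delta>f g + f \<Delta>g\<close> and \<open>4\<close> divides both \<open>\<Delta>f\<close> and \<open>\<Delta>g\<close>.\<close>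

lemma odd_smooth_symmetrized_product:
  assumes "odd_smooth f" "odd_smooth g"
  obtains h where "odd_smooth h" "\<And>x. f (Suc x) * g x + f x * g (Suc x) = 2 * h x"
proof -
  define d where "d x = fwd_diff f x * g x + f x * fwd_diff g x" for x
  have d: "diff_dvd 2 d"
    unfolding d_def
    using diff_dvd_mult [of 2 "fwd_diff f" 0 g] diff_dvd_mult [of 0 f 2 "fwd_diff g", unfolded add_0] assms
    by (intro diff_dvd_add) (simp_all add: smooth_def odd_smooth_def smooth_imp_diff_dvd)
  have "2 ^ (0 + 2) dvd (fwd_diff ^^ 0) d x" for x
    using d unfolding diff_dvd_def by blast
  then have "4 dvd d x" for x by simp
  then obtain q where q: "\<And>x. d x = 4 * q x" unfolding dvd_def by metis
  have "d = (\<lambda>x. 2 * (2 * q x))" using q by auto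
  \<comment> \<open>Halving lowers the level from 2 to 1, which still suffices for
    \<open>diff_dvd_imp_smooth\<close>.\<close>
  then have "diff_dvd 1 (\<lambda>x. 2 * q x)" using d diff_dvd_half [of 1 "\<lambda>x. 2 * q x"] by (simp add: numeral_2_eq_2)
  then have "odd_smooth (\<lambda>x. f x * g x + 2 * q x)"
    using assms smooth_add [OF smooth_mult diff_dvd_imp_smooth, of f g "\<lambda>x. 2 * q x"]
    by (simp add: odd_smooth_def)
  moreover have "f (Suc x) * g x + f x * g (Suc x) = 2 * (f x * g x + 2 * q x)" for x
    using q [of x] by (simp add: d_def fwd_diff_def algebra_simps)
  ultimately show ?thesis using that by blast
qed

section \<open>The power of two in the convolution\<close>

abbreviation catalan_val :: "nat \<Rightarrow> nat" where
  "catalan_val n \<equiv> multiplicity 2 (catalan n)"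

text \<open>Subadditivity of digit sums for \<open>(k + 1) + (n - k + 1) = n + 2\<close>. The extra
  1 is the factor 2 that pairing supplies.\<close>

lemma catalan_val_Suc_le:
  assumes "k \<le> n"
  shows "catalan_val (Suc n) \<le> Suc (catalan_val k + catalan_val (n - k))"
  using binary_digit_sum_add_le [of "Suc k" "Suc (n - k)"] assms
    multiplicity_catalan [of "Suc n"] multiplicity_catalan [of k] multiplicity_catalan [of "n - k"]
  by simp

text \<open>Makes the unpaired middle term \<open>k = n - k\<close> divisible enough without any
  gain from pairing.\<close>

lemma catalan_val_Suc_double: "catalan_val (Suc (2 * k)) = catalan_val k"
  using multiplicity_catalan [of "Suc (2 * k)"] multiplicity_catalan [of k]
    binary_digit_sum_double [of "Suc k"] by simp

lemma sum_fold_symmetric: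
  fixes h :: "nat \<Rightarrow> int"
  shows "(\<Sum>k\<le>n. h k) = (\<Sum>k | 2 * k < n. h k + h (n - k)) + (if even n then h (n div 2) else 0)"
proof -
  have fin: "finite {k. 2 * k < n}" "finite {k. 2 * k = n}"
    by (rule finite_subset [of _ "{..n}"]; auto)+
  have "{..n} = {k. 2 * k < n} \<union> (\<lambda>k. n - k) ` {k. 2 * k < n} \<union> {k. 2 * k = n}"
  proof -
    have "k \<in> (\<lambda>k. n - k) ` {k. 2 * k < n}" if "k \<le> n" "n < 2 * k" for k
      using that by (intro image_eqI [of _ _ "n - k"]) auto
    then show ?thesis by (auto simp: not_less) (metis linorder_neqE_nat)+
  qed
  then have "(\<Sum>k\<le>n. h k) = (\<Sum>k | 2 * k < n. h k) + (\<Sum>k\<in>(\<lambda>k. n - k) ` {k. 2 * k < n}. h k)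
      + (\<Sum>k | 2 * k = n. h k)"
    by (simp add: fin) (subst sum.union_disjoint; (auto simp: fin)?; subst sum.union_disjoint; auto simp: fin)
  also have "(\<Sum>k\<in>(\<lambda>k. n - k) ` {k. 2 * k < n}. h k) = (\<Sum>k | 2 * k < n. h (n - k))"
    by (subst sum.reindex) (auto simp: inj_on_def)
  also have "(\<Sum>k | 2 * k = n. h k) = (if even n then h (n div 2) else 0)"
  proof -
    have "{k. 2 * k = n} = (if even n then {n div 2} else {})" by auto
    then show ?thesis by simp
  qed
  finally show ?thesis by (simp add: sum.distrib)
qed

lemma even_sum_cong:
  fixes f g :: "'a \<Rightarrow> int"
  shows "(\<And>k. k \<in> A \<Longrightarrow> even (f k) \<longleftrightarrow> even (g k)) \<Longrightarrow> even (sum f A) \<longleftrightarrow> even (sum g A)"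
  by (induction A rule: infinite_finite_induct) auto

text \<open>The contributions of the unordered pairs \<open>{k, n - k}\<close> to \<open>C\<^bsub>n+1\<^esub>\<close>, each replaced by its power
  of two, relative to the power of two in \<open>C\<^bsub>n+1\<^esub>\<close>.\<close>

definition excess_sum :: "nat \<Rightarrow> int" where
  "excess_sum n =
     (\<Sum>k | 2 * k < n. 2 ^ (Suc (catalan_val k + catalan_val (n - k)) - catalan_val (Suc n)))
     + (if even n then 2 ^ (2 * catalan_val (n div 2) - catalan_val (Suc n)) else 0)"

text \<open>The parity criterion obtained depends on \<open>n\<close> alone and not on
  \<open>b\<close>, so it can be transferred from one sequence to all others.\<close>

lemma shifted_catalan_Suc_factor:
  assumes b: "odd_smooth b"
    and IH: "\<And>k. k \<le> n \<Longrightarrow> \<exists>f. odd_smooth f \<and> (\<forall>x. shifted_catalan b k x = 2 ^ catalan_val k * f x)"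
  obtains f where "smooth f" "\<And>x. shifted_catalan b (Suc n) x = 2 ^ catalan_val (Suc n) * f x"
    "\<And>x. even (f x) \<longleftrightarrow> even (excess_sum n)"
proof -
  let ?v = catalan_val
  obtain F where F: "\<And>k. k \<le> n \<Longrightarrow> odd_smooth (F k)"
    "\<And>k x. k \<le> n \<Longrightarrow> shifted_catalan b k x = 2 ^ ?v k * F k x"
    using IH by metis
  have "\<exists>h. odd_smooth h \<and> (\<forall>x. F k (Suc x) * F (n - k) x + F k x * F (n - k) (Suc x) = 2 * h x)"
    if "2 * k < n" for k
    using that F(1) odd_smooth_symmetrized_product [of "F k" "F (n - k)"]
    by (metis diff_le_self le_add2 le_trans less_imp_le mult_2)
  then obtain H where H: "\<And>k. 2 * k < n \<Longrightarrow> odd_smooth (H k)"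
    "\<And>k x. 2 * k < n \<Longrightarrow> F k (Suc x) * F (n - k) x + F k x * F (n - k) (Suc x) = 2 * H k x"
    by metis
  define M where "M x = F (n div 2) (Suc x) * F (n div 2) x" for x
  have M: "odd_smooth M"
    using F(1) [of "n div 2"] unfolding M_def odd_smooth_def
    by (auto intro: smooth_mult smooth_shift)
  \<comment> \<open>Both truncated subtractions are exact where they are used: by
    \<open>catalan_val_Suc_le\<close> for the pairs, and by \<open>catalan_val_Suc_double\<close>
    for the middle term when \<open>n\<close> is even.\<close>
  define p where "p k = Suc (?v k + ?v (n - k)) - ?v (Suc n)" for k
  define r where "r = 2 * ?v (n div 2) - ?v (Suc n)"
  define f where "f x = b x * ((\<Sum>k | 2 * k < n. 2 ^ p k * H k x) + (if even n then 2 ^ r * M x else 0))"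
    for x
  show ?thesis
  proof
    show "smooth f"
      using b H(1) M unfolding f_def odd_smooth_def
      by (cases "even n") (auto intro!: smooth_mult smooth_add smooth_sum)
    show "even (f x) \<longleftrightarrow> even (excess_sum n)" for x
    proof -
      have "even (\<Sum>k | 2 * k < n. 2 ^ p k * H k x) \<longleftrightarrow> even (\<Sum>k | 2 * k < n. 2 ^ p k :: int)"
        using H(1) by (intro even_sum_cong) (auto simp: odd_smooth_def)
      then show ?thesis
        using b M by (simp add: f_def excess_sum_def p_def r_def odd_smooth_def)
    qed
    show "shifted_catalan b (Suc n) x = 2 ^ ?v (Suc n) * f x" for x
    proof -
      define h where "h k = shifted_catalan b k (Suc x) * shifted_catalan b (n - k) x" for k
      have pair: "h k + h (n - k) = 2 ^ ?v (Suc n) * (2 ^ p k * H k x)" if "2 * k < n" for k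
      proof -
        have "h k + h (n - k) = 2 ^ (?v k + ?v (n - k))
            * (F k (Suc x) * F (n - k) x + F k x * F (n - k) (Suc x))"
          using that by (simp add: h_def F(2) power_add algebra_simps)
        also have "\<dots> = 2 ^ (?v (Suc n) + p k) * H k x"
          using that catalan_val_Suc_le [of k n] by (simp add: H(2) p_def)
        finally show ?thesis by (simp add: power_add)
      qed
      have mid: "h (n div 2) = 2 ^ ?v (Suc n) * (2 ^ r * M x)" if "even n"
      proof -
        have "n - n div 2 = n div 2" "?v (Suc n) + r = ?v (n div 2) + ?v (n div 2)"
          using that catalan_val_Suc_double [of "n div 2"] by (auto simp: r_def)
        moreover have "h (n div 2) = 2 ^ (?v (n div 2) + ?v (n div 2)) * M x"
          using calculation(1) by (simp add: h_def F(2) M_def power_add)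
        ultimately show ?thesis by (metis mult.assoc power_add)
      qed
      have "shifted_catalan b (Suc n) x = b x * (\<Sum>k\<le>n. h k)"
        by (simp add: shifted_catalan.simps h_def)
      also have "(\<Sum>k\<le>n. h k) = 2 ^ ?v (Suc n) *
          ((\<Sum>k | 2 * k < n. 2 ^ p k * H k x) + (if even n then 2 ^ r * M x else 0))"
        by (simp add: sum_fold_symmetric pair mid distrib_left sum_distrib_left)
      finally show ?thesis by (simp add: f_def)
    qed
  qed
qed

text \<open>It suffices to take \<open>b = 1\<close>, where the cofactor is the odd part of
  \<open>catalan (Suc n)\<close>. The odd parts of the smaller Catalan numbers, as constant
  functions, supply the required factorizations.\<close>

lemma odd_excess_sum: "odd (excess_sum n)"
proof -
  have "\<exists>q. odd q \<and> int (catalan k) = 2 ^ catalan_val k * q" for k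
  proof -
    obtain y where "catalan k = 2 ^ catalan_val k * y" "odd y"
      by (rule multiplicity_decompose' [of "catalan k" 2]) (use catalan_pos [of k] in auto)
    then show ?thesis by (intro exI [of _ "int y"]) (metis even_of_nat of_nat_mult of_nat_numeral of_nat_power)
  qed
  then obtain q where q: "\<And>k. odd (q k)" "\<And>k. int (catalan k) = 2 ^ catalan_val k * q k"
    by metis
  have one: "odd_smooth (\<lambda>_. 1)" by (simp add: odd_smooth_def)
  obtain f where "\<And>x. shifted_catalan (\<lambda>_. 1) (Suc n) x = 2 ^ catalan_val (Suc n) * f x"
    "\<And>x. even (f x) \<longleftrightarrow> even (excess_sum n)"
  proof (rule shifted_catalan_Suc_factor [OF one, of n])
    fix k
    show "\<exists>f. odd_smooth f \<and> (\<forall>x. shifted_catalan (\<lambda>_. 1) k x = 2 ^ catalan_val k * f x)"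
      using q by (intro exI [of _ "\<lambda>_. q k"]) (simp add: odd_smooth_def shifted_catalan_one)
  qed blast
  then show ?thesis using q [of "Suc n"] by (simp add: shifted_catalan_one)
qed

text \<open>All shifts \<open>x\<close> are treated at once, since the induction carries smoothness
  in \<open>x\<close>.\<close>

lemma shifted_catalan_factor:
  assumes "odd_smooth b"
  shows "\<exists>f. odd_smooth f \<and> (\<forall>x. shifted_catalan b n x = 2 ^ catalan_val n * f x)"
proof (induction n rule: less_induct)
  case (less n)
  show ?case
  proof (cases n)
    case 0
    then show ?thesis
      by (intro exI [of _ "\<lambda>_. 1"]) (simp add: odd_smooth_def shifted_catalan.simps)
  next
    case (Suc m)
    obtain f where "smooth f" "\<And>x. shifted_catalan b (Suc m) x = 2 ^ catalan_val (Suc m) * f x"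
      "\<And>x. even (f x) \<longleftrightarrow> even (excess_sum m)"
      by (rule shifted_catalan_Suc_factor [OF assms, of m]) (use less.IH Suc in auto)
    then show ?thesis using odd_excess_sum [of m] Suc by (auto simp: odd_smooth_def)
  qed
qed

text \<open>Nonvanishing is part of the claim because \<open>multiplicity 2 0\<close> is
  \<open>0\<close> by convention; the cast to integers avoids truncated subtraction.\<close>

theorem theorem2p1:
  fixes b :: "nat \<Rightarrow> int" and n :: nat
  assumes "odd (b 0)"
    and "\<And>m x. m \<ge> 1 \<Longrightarrow> 2 ^ (m + 1) dvd (fwd_diff ^^ m) b x"
  shows "weighted_catalan b n \<noteq> 0
    \<and> multiplicity 2 (weighted_catalan b n) = multiplicity 2 (catalan n)
    \<and> int (multiplicity 2 (catalan n)) = int (binary_digit_sum (n + 1)) - 1"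
proof -
  have "smooth b" using assms(2) by (rule smoothI)
  \<comment> \<open>Smoothness makes the parity constant, so oddness of \<open>b 0\<close> spreads
    to all values.\<close>
  then have "odd_smooth b"
    using assms(1) smooth_parity [of b] unfolding odd_smooth_def by blast
  then obtain f where f: "odd_smooth f" "weighted_catalan b n = 2 ^ catalan_val n * f 0"
    using shifted_catalan_factor weighted_catalan_eq by metis
  from f(1) have "odd (f 0)" by (simp add: odd_smooth_def)
  moreover from this have "multiplicity 2 (2 ^ catalan_val n * f 0) = catalan_val n"
    by (intro multiplicity_eqI) auto
  ultimately show ?thesis using f(2) multiplicity_catalan [of n] by auto
qed

end
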